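(* $\{C\vee\Pi: C\in\mathcal{C}\}=\{C^\uparrow: C\in\mathcal{C}\}=\mathcal{C}^\uparrow$.
   Context: $\mathcal{C}$ is the class of bivariate copulas; $\partial_2$ the partial derivative in the second argument; $\Pi(u,v)=uv$; $D\vee E(u,v):=\int_0^1\min\{\partial_2D(u,t),\partial_2E(v,t)\}\,dt$. $\mathcal{C}^\uparrow$ is the class of SI copulas, i.e. copulas $C$ with $C(v,\cdot)$ concave for every $v\in[0,1]$. For measurable $h:(0,1)\to[0,1]$, $h^*$ denotes the a.e.-unique decreasing function with $\lambda(h^*\le y)=\lambda(h\le y)$ for all $y\in[0,1]$; $C^\uparrow(v,u):=\int_0^uh_v^*(t)\,dt$ with $h_v=\partial_2C(v,\cdot)$. *)

theory Defs
  imports "HOL-Analysis.Analysis"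
begin

text \<open>Bivariate copulas, represented as functions real => real => real which are
  set to 0 outside the unit square (normalisation convention, so that set equalities
  of classes of copulas are meaningful).\<close>
definition copula :: "(real \<Rightarrow> real \<Rightarrow> real) \<Rightarrow> bool" where
  "copula C \<longleftrightarrow>
     (\<forall>u v. \<not> (u \<in> {0..1} \<and> v \<in> {0..1}) \<longrightarrow> C u v = 0) \<and>
     (\<forall>u\<in>{0..1}. C u 0 = 0 \<and> C 0 u = 0 \<and> C u 1 = u \<and> C 1 u = u) \<and>
     (\<forall>u1 u2 v1 v2. 0 \<le> u1 \<and> u1 \<le> u2 \<and> u2 \<le> 1 \<and> 0 \<le> v1 \<and> v1 \<le> v2 \<and> v2 \<le> 1 \<longrightarrow>
        C u2 v2 - C u2 v1 - C u1 v2 + C u1 v1 \<ge> 0)"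

definition copulas :: "(real \<Rightarrow> real \<Rightarrow> real) set" where
  "copulas = {C. copula C}"

definition d2 :: "(real \<Rightarrow> real \<Rightarrow> real) \<Rightarrow> real \<Rightarrow> real \<Rightarrow> real" where
  "d2 D u t = deriv (\<lambda>s. D u s) t"

definition Pi_cop :: "real \<Rightarrow> real \<Rightarrow> real" where
  "Pi_cop u v = (if u \<in> {0..1} \<and> v \<in> {0..1} then u * v else 0)"

definition join :: "(real \<Rightarrow> real \<Rightarrow> real) \<Rightarrow> (real \<Rightarrow> real \<Rightarrow> real) \<Rightarrow> real \<Rightarrow> real \<Rightarrow> real" where
  "join D E u v = (if u \<in> {0..1} \<and> v \<in> {0..1}
     then (LINT t:{0..1}|lebesgue. min (d2 D u t) (d2 E v t)) else 0)"

definition decr_rearr :: "(real \<Rightarrow> real) \<Rightarrow> real \<Rightarrow> real" where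
  "decr_rearr h = (SOME g. (\<forall>t\<in>{0<..<1}. g t \<in> {0..1}) \<and> antimono_on {0<..<1} g \<and>
      (\<forall>y\<in>{0..1}. measure lebesgue {t\<in>{0<..<1}. g t \<le> y}
                 = measure lebesgue {t\<in>{0<..<1}. h t \<le> y}))"

definition SI_up :: "(real \<Rightarrow> real \<Rightarrow> real) \<Rightarrow> real \<Rightarrow> real \<Rightarrow> real" where
  "SI_up C v u = (if v \<in> {0..1} \<and> u \<in> {0..1}
     then (LINT t:{0..u}|lebesgue. decr_rearr (\<lambda>s. d2 C v s) t) else 0)"

definition SI_copulas :: "(real \<Rightarrow> real \<Rightarrow> real) set" where
  "SI_copulas = {C. copula C \<and> (\<forall>v\<in>{0..1}. concave_on {0..1} (C v))}"

end

(* Write h_v for the derivative of C(v,.) and mu_v(y) for the measure of {h_v > y}.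
   Since min(h_v(t),u) grows in u at rate 1 exactly while u < h_v(t), the section of the join of C with Pi
   at v has derivative mu_v almost everywhere. On the other hand the level sets of a decreasing function
   are initial intervals, so by the layer-cake formula its integral over [0,u] is the integral of
   min(mu(y),u) over y in [0,1], where mu(y) is the measure of its level set at y; as the rearrangement of
   h_v has the same mu_v, the SI rearrangement of C is C joined with Pi twice. The join with Pi is an SI
   copula, because min(h,v) is supermodular in (h,v) and concave in v. An SI copula has decreasing h_v, so
   rearrangement fixes it, and all three classes coincide.

   Everything rests on C(v,.), which is increasing and 1-Lipschitz, being almost everywhere differentiable
   and the integral of its derivative; this is obtained from the Vitali covering theorem and dominated
   convergence of difference quotients. *)

theory Submission
  imports Defs "HOL-Probability.Weak_Convergence"
begin

subsection \<open>Differentiability of Lipschitz monotone functions\<close>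

lemma emeasure_interval_measure_ball:
  fixes F :: "real \<Rightarrow> real"
  assumes F: "mono F" "continuous_on UNIV F" and r: "0 < r"
  shows "emeasure (interval_measure F) (ball c r) = ennreal (F (c + r) - F (c - r))"
proof -
  let ?M = "interval_measure F"
  have Icc: "emeasure ?M {a..b} = ennreal (F b - F a)" if "a \<le> b" for a b
    using that F by (intro emeasure_interval_measure_Icc) (auto simp: mono_def)
  \<comment> \<open>Continuity of \<open>F\<close> leaves no atoms, so the open ball and its closure
    have the same mass.\<close>
  have "AE x in ?M. x \<noteq> y" for y
    using Icc[of y y] by (intro AE_I[where N = "{y}"]) auto
  then have "AE x in ?M. x \<in> {c - r..c + r} \<longleftrightarrow> x \<in> ball c r"
    using \<open>AE x in ?M. x \<noteq> c - r\<close> \<open>AE x in ?M. x \<noteq> c + r\<close>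
    by eventually_elim (auto simp: ball_eq_greaterThanLessThan)
  then have "emeasure ?M (ball c r) = emeasure ?M {c - r..c + r}"
    by (intro emeasure_eq_AE) auto
  with Icc r show ?thesis by simp
qed

lemma emeasure_lborel_ball_real:
  "0 < r \<Longrightarrow> emeasure lborel (ball (c::real) r) = ennreal (2 * r)"
  by (simp add: ball_eq_greaterThanLessThan)

text \<open>The intervals must contain \<open>x\<close> but need not be centred there, so the set is
  a countable intersection of unions of open sets and its defining intervals form a Vitali cover.
  Membership of \<open>x\<close> forces \<open>r > 0\<close>. Outside the set, all sufficiently
  short intervals around \<open>x\<close> have slope at least \<open>p\<close>.\<close>

definition slope_below :: "(real \<Rightarrow> real) \<Rightarrow> real \<Rightarrow> real set" where
  "slope_below F p = {x. \<forall>d>0. \<exists>c r. r < d \<and> x \<in> ball c r \<and> F (c + r) - F (c - r) < p * (2 * r)}"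

definition slope_above :: "(real \<Rightarrow> real) \<Rightarrow> real \<Rightarrow> real set" where
  "slope_above F q = {x. \<forall>d>0. \<exists>c r. r < d \<and> x \<in> ball c r \<and> q * (2 * r) < F (c + r) - F (c - r)}"

text \<open>It suffices to test \<open>d\<close> along \<open>1 / real (Suc n)\<close>, which leaves
  a countable intersection; the unions inside may be uncountable because their members are
  open.\<close>

lemma borel_all_small_balls:
  fixes P :: "real \<Rightarrow> real \<Rightarrow> bool"
  shows "{x. \<forall>d>0. \<exists>c r. r < d \<and> x \<in> ball c r \<and> P c r} \<in> sets borel"
proof -
  have "{x. \<forall>d>0. \<exists>c r. r < d \<and> x \<in> ball c r \<and> P c r} =
        (\<Inter>n. \<Union>(c, r) \<in> {(c, r). r < 1 / real (Suc n) \<and> P c r}. ball c r)" (is "?L = ?R")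
  proof (intro set_eqI iffI)
    fix x assume "x \<in> ?R"
    then have *: "\<exists>c r. r < 1 / real (Suc n) \<and> x \<in> ball c r \<and> P c r" for n
      by blast
    show "x \<in> ?L"
    proof (intro CollectI allI impI)
      fix d :: real assume "d > 0"
      then obtain n where "1 / real (Suc n) < d"
        using nat_approx_posE by blast
      with *[of n] show "\<exists>c r. r < d \<and> x \<in> ball c r \<and> P c r"
        by (meson less_trans)
    qed
  next
    fix x assume x: "x \<in> ?L"
    have "\<exists>c r. r < 1 / real (Suc n) \<and> x \<in> ball c r \<and> P c r" for n
      using x by auto
    then show "x \<in> ?R" by blast
  qed
  also have "\<dots> \<in> sets borel"
    by (intro sets.countable_INT) (auto intro!: borel_open)
  finally show ?thesis .
qed

lemma disjoint_family_on_balls: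
  assumes "pairwise (\<lambda>i j. disjnt (ball (fst i) (snd i)) (ball (fst j) (snd j))) C"
  shows "disjoint_family_on (\<lambda>i. ball (fst i) (snd i)) C"
  using assms by (auto simp: disjoint_family_on_def pairwise_def disjnt_def)

lemma borel_null_if_negligible:
  "A \<in> sets borel \<Longrightarrow> negligible A \<Longrightarrow> A \<in> null_sets (lborel :: 'a::euclidean_space measure)"
  by (simp add: negligible_iff_null_sets null_sets_completion_iff)

lemma null_slope_below_above_bounded:
  fixes F :: "real \<Rightarrow> real"
  assumes F: "mono F" "continuous_on UNIV F" and pq: "0 \<le> p" "p < q"
    and E: "E \<in> sets borel" "E \<subseteq> slope_below F p \<inter> slope_above F q" "emeasure lborel E < \<infinity>"
  shows "E \<in> null_sets lborel"
  \<comment> \<open>Cover \<open>E\<close> by disjoint intervals of slope below \<open>p\<close> inside an open set \<open>T\<close> barely larger than \<open>E\<close>,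
    then by disjoint intervals of slope above \<open>q\<close> inside the first ones. With the Stieltjes
    measure \<open>\<mu>\<close> of \<open>F\<close> and the unions \<open>U2 \<subseteq> U1\<close> of the two families,
    \<open>q |E| \<le> q |U2| \<le> \<mu> U2 \<le> \<mu> U1 \<le> p |U1| \<le> p |T|\<close>.\<close>
proof -
  let ?I = "interval_measure F" and ?b = "\<lambda>i::real \<times> real. ball (fst i) (snd i)"
  let ?m = "measure lborel E"
  have m: "emeasure lborel E = ennreal ?m"
    using E(3) by (intro emeasure_eq_ennreal_measure) auto
  have outer: "q * ?m \<le> p * ?m + p * e" if "e > 0" for e
  proof -
    obtain T where T: "open T" "E \<subseteq> T" "T - E \<in> lmeasurable" "emeasure lebesgue (T - E) < ennreal e"
      using sets_lebesgue_outer_open[of E e] E(1) \<open>e > 0\<close> by auto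
    have "emeasure lborel T = emeasure lborel (E \<union> (T - E))"
      using T(2) by (simp add: Un_absorb1)
    also have "\<dots> = emeasure lborel E + emeasure lborel (T - E)"
      using E(1) T(1) by (intro plus_emeasure[symmetric]) auto
    also have "emeasure lborel (T - E) \<le> ennreal e"
      using T(1,4) E(1) by simp
    finally have eT: "emeasure lborel T \<le> ennreal (?m + e)"
      using m \<open>e > 0\<close> by (simp add: ennreal_plus)

    define K1 where "K1 = {i. ?b i \<subseteq> T \<and> 0 < snd i \<and> F (fst i + snd i) - F (fst i - snd i) < p * (2 * snd i)}"
    have cov1: "\<exists>i. i \<in> K1 \<and> x \<in> ?b i \<and> snd i < d" if x: "x \<in> E" and "d > 0" for x d
    proof -
      from x T obtain s where s: "s > 0" "ball x s \<subseteq> T"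
        by (meson open_contains_ball subset_iff)
      have "x \<in> slope_below F p" using x E(2) by auto
      moreover have "min d (s/2) > 0" using \<open>d > 0\<close> s by auto
      ultimately obtain c r where cr: "r < min d (s / 2)" "x \<in> ball c r"
          "F (c + r) - F (c - r) < p * (2 * r)"
        unfolding slope_below_def by blast
      \<comment> \<open>A ball of radius below \<open>s / 2\<close> containing \<open>x\<close> has
        diameter below \<open>s\<close>.\<close>
      have "ball c r \<subseteq> ball x s"
        using cr by (auto simp: dist_real_def)
      with cr s show ?thesis
        by (intro exI[of _ "(c, r)"]) (auto simp: K1_def dist_real_def)
    qed
    obtain C1 where C1: "countable C1" "C1 \<subseteq> K1"
        "pairwise (\<lambda>i j. disjnt (?b i) (?b j)) C1" "negligible (E - (\<Union>i\<in>C1. ?b i))"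
      by (rule Vitali_covering_theorem_balls[of E K1 fst snd, OF cov1]) auto
    define U1 where "U1 = (\<Union>i\<in>C1. ?b i)"
    have U1: "open U1" "U1 \<subseteq> T" using C1(2) by (auto simp: U1_def K1_def)

    define K2 where "K2 = {i. ?b i \<subseteq> U1 \<and> 0 < snd i \<and> q * (2 * snd i) < F (fst i + snd i) - F (fst i - snd i)}"
    have cov2: "\<exists>i. i \<in> K2 \<and> x \<in> ?b i \<and> snd i < d" if x: "x \<in> E \<inter> U1" and "d > 0" for x d
    proof -
      from x U1 obtain s where s: "s > 0" "ball x s \<subseteq> U1"
        by (meson open_contains_ball subset_iff Int_iff)
      have "x \<in> slope_above F q" using x E(2) by auto
      moreover have "min d (s/2) > 0" using \<open>d > 0\<close> s by auto
      ultimately obtain c r where cr: "r < min d (s / 2)" "x \<in> ball c r"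
          "q * (2 * r) < F (c + r) - F (c - r)"
        unfolding slope_above_def by blast
      have "ball c r \<subseteq> ball x s"
        using cr by (auto simp: dist_real_def)
      with cr s show ?thesis
        by (intro exI[of _ "(c, r)"]) (auto simp: K2_def dist_real_def)
    qed
    obtain C2 where C2: "countable C2" "C2 \<subseteq> K2"
        "pairwise (\<lambda>i j. disjnt (?b i) (?b j)) C2" "negligible (E \<inter> U1 - (\<Union>i\<in>C2. ?b i))"
      by (rule Vitali_covering_theorem_balls[of "E \<inter> U1" K2 fst snd, OF cov2]) auto
    define U2 where "U2 = (\<Union>i\<in>C2. ?b i)"
    have U2: "open U2" "U2 \<subseteq> U1" using C2(2) by (auto simp: U2_def K2_def)

    \<comment> \<open>A point of \<open>E\<close> missed by \<open>U2\<close> is either missed by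
      \<open>U1\<close> or lies in \<open>E \<inter> U1\<close> and is missed by the second family;
      both sets are negligible.\<close>
    have "negligible (E - U2)"
      by (rule negligible_subset[OF negligible_Un[OF C1(4) C2(4)]]) (auto simp: U1_def U2_def)
    then have "E - U2 \<in> null_sets lborel"
      using E(1) U2(1) by (intro borel_null_if_negligible) auto
    then have "emeasure lborel E = emeasure lborel (E - (E - U2))"
      using E(1) by (simp add: emeasure_Diff_null_set)
    also have "\<dots> \<le> emeasure lborel U2"
      using U2(1) by (intro emeasure_mono) auto
    finally have "ennreal q * emeasure lborel E \<le> ennreal q * emeasure lborel U2"
      by (rule mult_left_mono) auto
    also have "emeasure lborel U2 = (\<integral>\<^sup>+i. emeasure lborel (?b i) \<partial>count_space C2)"
      unfolding U2_def using C2(1,3)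
      by (intro emeasure_UN_countable disjoint_family_on_balls) auto
    also have "ennreal q * \<dots> = (\<integral>\<^sup>+i. ennreal q * emeasure lborel (?b i) \<partial>count_space C2)"
      by (intro nn_integral_cmult[symmetric]) auto
    also have "\<dots> \<le> (\<integral>\<^sup>+i. emeasure ?I (?b i) \<partial>count_space C2)"
    proof (intro nn_integral_mono)
      fix i assume "i \<in> space (count_space C2)"
      then have i: "0 < snd i" "q * (2 * snd i) < F (fst i + snd i) - F (fst i - snd i)"
        using C2(2) by (auto simp: K2_def)
      show "ennreal q * emeasure lborel (?b i) \<le> emeasure ?I (?b i)"
        using i pq F
        by (subst emeasure_interval_measure_ball)
          (auto simp: emeasure_lborel_ball_real ennreal_mult[symmetric] intro!: ennreal_leI)
    qed
    also have "\<dots> = emeasure ?I U2"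
      unfolding U2_def using C2(1,3)
      by (intro emeasure_UN_countable[symmetric] disjoint_family_on_balls) auto
    also have "\<dots> \<le> emeasure ?I U1"
      using U1(1) U2(2) by (intro emeasure_mono) auto
    also have "\<dots> = (\<integral>\<^sup>+i. emeasure ?I (?b i) \<partial>count_space C1)"
      unfolding U1_def using C1(1,3)
      by (intro emeasure_UN_countable disjoint_family_on_balls) auto
    also have "\<dots> \<le> (\<integral>\<^sup>+i. ennreal p * emeasure lborel (?b i) \<partial>count_space C1)"
    proof (intro nn_integral_mono)
      fix i assume "i \<in> space (count_space C1)"
      then have i: "0 < snd i" "F (fst i + snd i) - F (fst i - snd i) < p * (2 * snd i)"
        using C1(2) by (auto simp: K1_def)
      show "emeasure ?I (?b i) \<le> ennreal p * emeasure lborel (?b i)"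
        using i pq F
        by (subst emeasure_interval_measure_ball)
          (auto simp: emeasure_lborel_ball_real ennreal_mult[symmetric] intro!: ennreal_leI)
    qed
    also have "\<dots> = ennreal p * (\<integral>\<^sup>+i. emeasure lborel (?b i) \<partial>count_space C1)"
      by (intro nn_integral_cmult) auto
    also have "(\<integral>\<^sup>+i. emeasure lborel (?b i) \<partial>count_space C1) = emeasure lborel U1"
      unfolding U1_def using C1(1,3)
      by (intro emeasure_UN_countable[symmetric] disjoint_family_on_balls) auto
    also have "\<dots> \<le> emeasure lborel T"
      using T(1) U1(2) by (intro emeasure_mono) auto
    also note eT
    finally have "ennreal (q * ?m) \<le> ennreal (p * (?m + e))"
      using pq m \<open>e > 0\<close> by (simp add: ennreal_mult mult_left_mono)
    then have "q * ?m \<le> p * (?m + e)"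
      using pq \<open>e > 0\<close> by (subst (asm) ennreal_le_iff) auto
    then show ?thesis by (simp add: algebra_simps)
  qed
  have "q * ?m \<le> p * ?m"
  proof (rule field_le_epsilon)
    fix e :: real assume "e > 0"
    \<comment> \<open>Dividing by \<open>p + 1\<close> rather than \<open>p\<close> covers the case
      \<open>p = 0\<close>.\<close>
    have "q * ?m \<le> p * ?m + p * (e / (p + 1))"
      using \<open>e > 0\<close> pq by (intro outer) auto
    also have "p * (e / (p + 1)) \<le> e"
      using \<open>e > 0\<close> pq by (simp add: field_simps)
    finally show "q * ?m \<le> p * ?m + e" by simp
  qed
  moreover have "?m \<ge> 0" by simp
  ultimately have "?m = 0"
    using pq by (metis mult_right_mono_neg mult_strict_right_mono not_le order_less_le)
  with m E(1) show ?thesis by (simp add: null_sets_def)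
qed

text \<open>The covering estimate needs finite measure, so the set is cut by the intervals from
  \<open>-n\<close> to \<open>n\<close>.\<close>

lemma null_slope_below_above:
  fixes F :: "real \<Rightarrow> real"
  assumes F: "mono F" "continuous_on UNIV F" and pq: "0 \<le> p" "p < q"
  shows "slope_below F p \<inter> slope_above F q \<in> null_sets lborel"
proof -
  let ?E = "slope_below F p \<inter> slope_above F q"
  have [measurable]: "slope_below F p \<in> sets borel" "slope_above F q \<in> sets borel"
    unfolding slope_below_def slope_above_def by (intro borel_all_small_balls)+
  have "?E \<inter> {-real n..real n} \<in> null_sets lborel" for n
  proof (rule null_slope_below_above_bounded[OF F pq])
    show "emeasure lborel (?E \<inter> {-real n..real n}) < \<infinity>"
      by (rule le_less_trans[OF emeasure_mono[of _ "{-real n..real n}"]]) auto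
  qed auto
  then have "(\<Union>n. ?E \<inter> {-real n..real n}) \<in> null_sets lborel"
    by (intro null_sets_UN)
  also have "(\<Union>n. ?E \<inter> {-real n..real n}) = ?E"
  proof -
    have "\<exists>n. x \<in> {-real n..real n}" for x
      by (metis abs_le_iff atLeastAtMost_iff minus_le_iff real_arch_simple)
    then show ?thesis by blast
  qed
  finally show ?thesis .
qed

section \<open>Almost everywhere differentiability and recovery from the derivative\<close>

lemma mono_lipschitz_continuous:
  fixes F :: "real \<Rightarrow> real"
  assumes "mono F" "\<And>x y. x \<le> y \<Longrightarrow> F y - F x \<le> y - x"
  shows "continuous_on S F"
proof (rule continuous_on_subset[OF lipschitz_on_continuous_on[of 1 UNIV]])
  show "1-lipschitz_on UNIV F"
  proof (rule lipschitz_onI)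
    fix x y :: real
    show "dist (F x) (F y) \<le> 1 * dist x y"
      using assms(2)[of x y] assms(2)[of y x] monoD[OF assms(1), of x y] monoD[OF assms(1), of y x]
      by (auto simp: dist_real_def abs_real_def)
  qed simp
qed simp

text \<open>Difference quotients are taken over closed intervals with \<open>x\<close> as an endpoint, whereas the slope
  conditions concern open intervals containing \<open>x\<close>; enlarging the interval slightly bridges the gap.\<close>

lemma slope_bounds_endpoint:
  fixes F :: "real \<Rightarrow> real"
  assumes F: "mono F" "\<And>x y. x \<le> y \<Longrightarrow> F y - F x \<le> y - x"
    and d: "\<And>c r. r < d \<Longrightarrow> x \<in> ball c r \<Longrightarrow>
      p * (2 * r) \<le> F (c + r) - F (c - r) \<and> F (c + r) - F (c - r) \<le> q * (2 * r)"
    and ab: "a \<le> x" "x \<le> b" "b - a < d"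
  shows "p * (b - a) \<le> F b - F a" "F b - F a \<le> q * (b - a)"
proof -
  have ev: "\<forall>\<^sub>F e in at_right 0. 0 < e \<and> e < d - (b - a)"
    using ab by (auto simp: eventually_at_right_field intro!: exI[of _ "d - (b - a)"])
  have *: "p * (b - a + 2 * e) \<le> F (b + e) - F (a - e) \<and> F (b + e) - F (a - e) \<le> q * (b - a + 2 * e)"
    if "0 < e \<and> e < d - (b - a)" for e
  proof -
    let ?c = "(a + b) / 2" and ?r = "(b - a) / 2 + e"
    have eq: "?c + ?r = b + e" "?c - ?r = a - e" "2 * ?r = b - a + 2 * e"
      by (simp_all add: field_simps)
    have "e < d - (b - a)" "a \<le> b" using that ab by auto
    then have "?r < d" by (simp add: field_simps)
    moreover have "x \<in> ball ?c ?r"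
      using that ab by (auto simp: dist_real_def abs_real_def field_simps)
    ultimately show ?thesis using d[of ?r ?c] unfolding eq by blast
  qed
  show "F b - F a \<le> q * (b - a)"
  proof (rule tendsto_lowerbound)
    show "((\<lambda>e. q * (b - a + 2 * e)) \<longlongrightarrow> q * (b - a)) (at_right 0)"
      by (auto intro!: tendsto_eq_intros)
    show "\<forall>\<^sub>F e in at_right 0. F b - F a \<le> q * (b - a + 2 * e)"
      using ev
    proof eventually_elim
      case (elim e)
      have "F b \<le> F (b + e)" "F (a - e) \<le> F a" using elim by (auto intro!: monoD[OF F(1)])
      with *[OF elim] show ?case by linarith
    qed
  qed simp
  \<comment> \<open>Monotonicity alone gave the upper bound; here enlarging the interval adds up to
    \<open>2 * e\<close> to the increment, by the Lipschitz bound, and this is subtracted.\<close>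
  show "p * (b - a) \<le> F b - F a"
  proof (rule tendsto_upperbound)
    show "((\<lambda>e. p * (b - a + 2 * e) - 2 * e) \<longlongrightarrow> p * (b - a)) (at_right 0)"
      by (auto intro!: tendsto_eq_intros)
    show "\<forall>\<^sub>F e in at_right 0. p * (b - a + 2 * e) - 2 * e \<le> F b - F a"
      using ev
    proof eventually_elim
      case (elim e)
      have "F (b + e) - F b \<le> e" "F a - F (a - e) \<le> e"
        using elim F(2)[of b "b + e"] F(2)[of "a - e" a] by auto
      with *[OF elim] show ?case by linarith
    qed
  qed simp
qed

text \<open>The candidate \<open>L\<close> is the upper derivative at \<open>x\<close>: above it,
  slopes of short intervals are bounded by definition. For \<open>0 \<le> p < L\<close>, take
  rationals \<open>p < p' < q' < L\<close>; then \<open>x\<close> is in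
  \<open>slope_above F q'\<close>, hence outside \<open>slope_below F p'\<close>, so short intervals
  have slope at least \<open>p'\<close>.\<close>

lemma differentiable_if_slopes_agree:
  fixes F :: "real \<Rightarrow> real"
  assumes F: "mono F" "\<And>x y. x \<le> y \<Longrightarrow> F y - F x \<le> y - x"
    and x: "\<And>p q. p \<in> \<rat> \<Longrightarrow> q \<in> \<rat> \<Longrightarrow> 0 \<le> p \<Longrightarrow> p < q \<Longrightarrow> x \<notin> slope_below F p \<inter> slope_above F q"
  shows "\<exists>L. (F has_real_derivative L) (at x)"
proof -
  define S where "S = {q. 0 \<le> q \<and> x \<notin> slope_above F q}"
  define L where "L = Inf S"
  have pos: "0 < r" if "x \<in> ball c r" for c r
    using that le_less_trans[OF zero_le_dist, of c x r] by simp
  \<comment> \<open>Slopes are at most 1, so 1 belongs to \<open>S\<close> and the infimum is over a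
    nonempty set.\<close>
  have "x \<notin> slope_above F 1"
  proof
    assume "x \<in> slope_above F 1"
    then obtain c r where cr: "x \<in> ball c r" "1 * (2 * r) < F (c + r) - F (c - r)"
      unfolding slope_above_def using zero_less_one by blast
    then show False using F(2)[of "c - r" "c + r"] pos[OF cr(1)] by simp
  qed
  then have S: "S \<noteq> {}" "bdd_below S" by (auto simp: S_def intro!: bdd_belowI[of _ 0] exI[of _ 1])
  have up: "\<exists>d>0. \<forall>c r. r < d \<longrightarrow> x \<in> ball c r \<longrightarrow> F (c + r) - F (c - r) \<le> q * (2 * r)" if Lq: "L < q" for q
  proof -
    obtain q' where q': "q' \<in> S" "q' < q"
      using S Lq by (auto simp: L_def cInf_less_iff)
    then obtain d where d: "d > 0" "\<And>c r. r < d \<Longrightarrow> x \<in> ball c r \<Longrightarrow> F (c + r) - F (c - r) \<le> q' * (2 * r)"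
      unfolding S_def slope_above_def mem_Collect_eq by (meson not_less)
    have "F (c + r) - F (c - r) \<le> q * (2 * r)" if "r < d" "x \<in> ball c r" for c r
      using d(2)[OF that] q'(2) pos[OF that(2)] mult_right_mono[of q' q "2 * r"] by linarith
    with d(1) show ?thesis by blast
  qed
  have low: "\<exists>d>0. \<forall>c r. r < d \<longrightarrow> x \<in> ball c r \<longrightarrow> p * (2 * r) \<le> F (c + r) - F (c - r)" if pL: "p < L" for p
  proof (cases "p < 0")
    \<comment> \<open>The hypothesis speaks of nonnegative \<open>p\<close> only; a negative
      \<open>p\<close> lies below every slope by monotonicity.\<close>
    case True
    have "p * (2 * r) \<le> F (c + r) - F (c - r)" if "x \<in> ball c r" for c r
    proof -
      have "p * (2 * r) \<le> 0" using True pos[OF that] by (simp add: mult_nonpos_nonneg)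
      moreover have "F (c - r) \<le> F (c + r)" using pos[OF that] by (intro monoD[OF F(1)]) auto
      ultimately show ?thesis by linarith
    qed
    then show ?thesis by (intro exI[of _ 1]) auto
  next
    case False
    obtain p' where p': "p' \<in> \<rat>" "p < p'" "p' < L" using Rats_dense_in_real[OF pL] by blast
    obtain q' where q': "q' \<in> \<rat>" "p' < q'" "q' < L" using Rats_dense_in_real[OF p'(3)] by blast
    have "q' \<notin> S" using q' S(2) cInf_lower[of q' S] by (auto simp: L_def)
    then have "x \<in> slope_above F q'" using False p' q' by (auto simp: S_def)
    with x[OF p'(1) q'(1)] False p' q' have "x \<notin> slope_below F p'" by auto
    then obtain d where d: "d > 0" "\<And>c r. r < d \<Longrightarrow> x \<in> ball c r \<Longrightarrow> p' * (2 * r) \<le> F (c + r) - F (c - r)"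
      unfolding slope_below_def mem_Collect_eq by (meson not_less)
    have "p * (2 * r) \<le> F (c + r) - F (c - r)" if "r < d" "x \<in> ball c r" for c r
      using d(2)[OF that] p'(2) pos[OF that(2)] mult_right_mono[of p p' "2 * r"] by linarith
    with d(1) show ?thesis by blast
  qed
  have "(F has_real_derivative L) (at x)"
    unfolding DERIV_def
  proof (rule LIM_I)
    fix e :: real assume e: "0 < e"
    \<comment> \<open>Half of \<open>e\<close> turns the non-strict slope bounds into the strict
      inequality of the limit.\<close>
    let ?p = "L - e / 2" and ?q = "L + e / 2"
    obtain d1 where d1: "d1 > 0" "\<forall>c r. r < d1 \<longrightarrow> x \<in> ball c r \<longrightarrow> F (c + r) - F (c - r) \<le> ?q * (2 * r)"
      using up[of ?q] e by auto
    obtain d2 where d2: "d2 > 0" "\<forall>c r. r < d2 \<longrightarrow> x \<in> ball c r \<longrightarrow> ?p * (2 * r) \<le> F (c + r) - F (c - r)"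
      using low[of ?p] e by auto
    define d where "d = min d1 d2"
    have d: "d > 0" "\<And>c r. r < d \<Longrightarrow> x \<in> ball c r \<Longrightarrow>
      ?p * (2 * r) \<le> F (c + r) - F (c - r) \<and> F (c + r) - F (c - r) \<le> ?q * (2 * r)"
      using d1 d2 by (auto simp: d_def)
    have "norm ((F (x + h) - F x) / h - L) < e" if h: "h \<noteq> 0" "norm (h - 0) < d" for h
    proof (cases "h > 0")
      case True
      have "?p * h \<le> F (x + h) - F x" "F (x + h) - F x \<le> ?q * h"
        using slope_bounds_endpoint[OF F d(2), where a = x and b = "x + h"] True h by auto
      then have "?p \<le> (F (x + h) - F x) / h" "(F (x + h) - F x) / h \<le> ?q"
        using True by (auto simp: field_simps)
      then show ?thesis using e by (auto simp: abs_real_def)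
    next
      case False
      then have neg: "h < 0" using h by auto
      have "?p * (- h) \<le> F x - F (x + h)" "F x - F (x + h) \<le> ?q * (- h)"
        using slope_bounds_endpoint[OF F d(2), where a = "x + h" and b = x] neg h by auto
      then have "?p \<le> (F (x + h) - F x) / h" "(F (x + h) - F x) / h \<le> ?q"
        using neg by (simp_all only: neg_le_divide_eq neg_divide_le_eq)
      then show ?thesis using e by (auto simp: abs_real_def)
    qed
    with d(1) show "\<exists>s>0. \<forall>h. h \<noteq> 0 \<and> norm (h - 0) < s \<longrightarrow> norm ((F (x + h) - F x) / h - L) < e"
      by blast
  qed
  then show ?thesis ..
qed

text \<open>Rational pairs suffice, so the exceptional points lie in a countable union of null
  sets.\<close>

theorem mono_lipschitz_AE_differentiable:
  fixes F :: "real \<Rightarrow> real"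
  assumes F: "mono F" "\<And>x y. x \<le> y \<Longrightarrow> F y - F x \<le> y - x"
  shows "AE x in lborel. \<exists>L. (F has_real_derivative L) (at x)"
proof -
  define I :: "(real \<times> real) set" where "I = {(p, q) \<in> \<rat> \<times> \<rat>. 0 \<le> p \<and> p < q}"
  have "countable I"
    unfolding I_def by (rule countable_subset[of _ "\<rat> \<times> \<rat>"]) (auto intro: countable_rat)
  then have "(\<Union>i\<in>I. slope_below F (fst i) \<inter> slope_above F (snd i)) \<in> null_sets lborel"
    using null_slope_below_above[OF F(1) mono_lipschitz_continuous[OF F]]
    by (intro null_sets_UN') (auto simp: I_def)
  then show ?thesis
  proof (rule AE_I', safe)
    fix x assume nd: "\<nexists>L. (F has_real_derivative L) (at x)"
    show "x \<in> (\<Union>i\<in>I. slope_below F (fst i) \<inter> slope_above F (snd i))"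
    proof (rule ccontr)
      assume "x \<notin> (\<Union>i\<in>I. slope_below F (fst i) \<inter> slope_above F (snd i))"
      then have "\<exists>L. (F has_real_derivative L) (at x)"
        by (intro differentiable_if_slopes_agree[OF F]) (auto simp: I_def)
      with nd show False by blast
    qed
  qed
qed

text \<open>The difference quotients of \<open>F\<close> with step \<open>e n\<close> lie between 0
  and 1 and converge to \<open>f\<close> almost everywhere. Their integrals are differences of
  difference quotients of an antiderivative \<open>P\<close> of \<open>F\<close>, so they tend to
  \<open>F b - F a\<close>; by dominated convergence they also tend to the integral of
  \<open>f\<close>.\<close>

theorem mono_lipschitz_density:
  fixes F :: "real \<Rightarrow> real"
  assumes F: "mono F" "\<And>x y. x \<le> y \<Longrightarrow> F y - F x \<le> y - x"
  obtains f where "f \<in> borel_measurable borel" "\<And>x. 0 \<le> f x \<and> f x \<le> 1"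
    "AE x in lborel. (F has_real_derivative f x) (at x)"
    "\<And>a b. a \<le> b \<Longrightarrow> (LINT t:{a..b}|lborel. f t) = F b - F a"
proof -
  define e where "e n = 1 / real (Suc n)" for n
  have e: "e n > 0" for n by (simp add: e_def)
  have e0: "e \<longlonglongrightarrow> 0" unfolding e_def using LIMSEQ_inverse_real_of_nat by (simp add: inverse_eq_divide)
  have e0': "filterlim e (at 0) sequentially"
    using e0 e by (simp add: filterlim_at less_imp_neq[symmetric])
  define s where "s n x = (F (x + e n) - F x) / e n" for n x
  \<comment> \<open>Clamping bounds \<open>f\<close> also where the quotients diverge and
    \<open>lim\<close> is unspecified; where \<open>F\<close> is differentiable it changes
    nothing.\<close>
  define f where "f x = max 0 (min 1 (lim (\<lambda>n. s n x)))" for x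
  have cont: "continuous_on S F" for S using mono_lipschitz_continuous[OF F] .
  then have Fm[measurable]: "F \<in> borel_measurable borel"
    by (intro borel_measurable_continuous_onI)
  have sm[measurable]: "s n \<in> borel_measurable borel" for n
    unfolding s_def by measurable
  have fm[measurable]: "f \<in> borel_measurable borel"
    unfolding f_def by measurable
  have s01: "0 \<le> s n x \<and> s n x \<le> 1" for n x
    using e[of n] F(2)[of x "x + e n"] monoD[OF F(1), of x "x + e n"]
    by (auto simp: s_def field_simps)
  have lim: "(\<lambda>n. s n x) \<longlonglongrightarrow> f x \<and> (F has_real_derivative f x) (at x)"
    if "\<exists>L. (F has_real_derivative L) (at x)" for x
  proof -
    from that obtain L where L: "(F has_real_derivative L) (at x)" ..
    then have "((\<lambda>h. (F (x + h) - F x) / h) \<longlongrightarrow> L) (at 0)" by (simp add: DERIV_def)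
    from filterlim_compose[OF this e0'] have lim: "(\<lambda>n. s n x) \<longlonglongrightarrow> L" by (simp add: s_def)
    have "0 \<le> L" "L \<le> 1"
      using s01 by (auto intro: LIMSEQ_le_const[OF lim] LIMSEQ_le_const2[OF lim])
    then have "f x = L" using limI[OF lim] by (simp add: f_def)
    with lim L show ?thesis by simp
  qed
  have AE: "AE x in lborel. (\<lambda>n. s n x) \<longlonglongrightarrow> f x \<and> (F has_real_derivative f x) (at x)"
    by (rule eventually_mono[OF mono_lipschitz_AE_differentiable[OF F] lim])
  have int: "(LINT t:{a..b}|lborel. f t) = F b - F a" if ab: "a \<le> b" for a b
  proof -
    obtain P where P: "\<And>x. (P has_real_derivative F x) (at x)"
      using einterval_antiderivative[of "-\<infinity>" "\<infinity>" F] cont[of UNIV]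
      by (auto simp: continuous_on_eq_continuous_at has_real_derivative_iff_has_vector_derivative)
    have ints: "(LINT t:{a..b}|lborel. s n t) = (P (b + e n) - P b) / e n - (P (a + e n) - P a) / e n" for n
    proof -
      have "((\<lambda>t. (P (t + e n) - P t) / e n) has_real_derivative s n x) (at x)" for x
        unfolding s_def using e[of n] P DERIV_shift[of P "F (x + e n)" x "e n"]
        by (auto intro!: derivative_eq_intros)
      moreover have "continuous_on UNIV (\<lambda>x. (F (x + e n) - F x) / e n)"
        using e[of n] by (intro continuous_intros continuous_on_compose2[OF cont[of UNIV]]) auto
      then have "isCont (s n) x" for x
        by (simp add: s_def[abs_def] continuous_on_eq_continuous_at)
      ultimately have "(LINT t|lborel. s n t * indicator {a..b} t) = (P (b + e n) - P b) / e n - (P (a + e n) - P a) / e n"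
        by (intro integral_FTC_Icc_real ab) auto
      then show ?thesis by (simp add: set_lebesgue_integral_def mult.commute)
    qed
    have "(\<lambda>n. (P (c + e n) - P c) / e n) \<longlonglongrightarrow> F c" for c
      using filterlim_compose[OF _ e0', of "\<lambda>h. (P (c + h) - P c) / h"] P[of c] by (simp add: DERIV_def)
    then have "(\<lambda>n. LINT t:{a..b}|lborel. s n t) \<longlonglongrightarrow> F b - F a"
      unfolding ints by (intro tendsto_diff)
    moreover have "(\<lambda>n. LINT t:{a..b}|lborel. s n t) \<longlonglongrightarrow> (LINT t:{a..b}|lborel. f t)"
      unfolding set_lebesgue_integral_def
    proof (rule integral_dominated_convergence[where w = "indicator {a..b}"])
      show "AE x in lborel. (\<lambda>n. indicator {a..b} x *\<^sub>R s n x) \<longlonglongrightarrow> indicator {a..b} x *\<^sub>R f x"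
        using AE by eventually_elim (auto intro!: tendsto_intros)
      show "AE x in lborel. norm (indicator {a..b} x *\<^sub>R s n x) \<le> indicator {a..b} x" for n
        using s01 by (auto simp: indicator_def)
    qed (auto intro!: integrable_real_indicator simp: emeasure_lborel_Icc_eq)
    ultimately show ?thesis by (rule LIMSEQ_unique[symmetric])
  qed
  show ?thesis
    by (rule that[of f]) (use AE int fm in \<open>auto simp: f_def elim: eventually_mono\<close>)
qed

subsection \<open>The join with the independence copula\<close>

lemma copula_increment_mono:
  assumes "copula C" "0 \<le> u1" "u1 \<le> u2" "u2 \<le> 1" "0 \<le> s" "s \<le> t" "t \<le> 1"
  shows "C u1 t - C u1 s \<le> C u2 t - C u2 s"
proof -
  have "C u2 t - C u2 s - C u1 t + C u1 s \<ge> 0"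
    using assms unfolding copula_def by blast
  then show ?thesis by linarith
qed

lemma copula_boundary:
  assumes "copula C" "u \<in> {0..1}"
  shows "C u 0 = 0" "C 0 u = 0" "C u 1 = u" "C 1 u = u"
  using assms unfolding copula_def by blast+

text \<open>Increments of sections grow with the first argument: comparison with the zero section at
  0 gives monotonicity, and with the identity section at 1 the Lipschitz bound that follows.\<close>

lemma copula_section_mono:
  assumes "copula C" "u \<in> {0..1}" "0 \<le> s" "s \<le> t" "t \<le> 1"
  shows "C u s \<le> C u t"
  using copula_increment_mono[of C 0 u s t] copula_boundary(2)[of C s] copula_boundary(2)[of C t] assms
  by simp

lemma copula_section_lipschitz:
  assumes "copula C" "u \<in> {0..1}" "0 \<le> s" "s \<le> t" "t \<le> 1"
  shows "C u t - C u s \<le> t - s"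
  using copula_increment_mono[of C u 1 s t] copula_boundary(4)[of C s] copula_boundary(4)[of C t] assms
  by simp

text \<open>A Borel representative of the derivative of \<open>C u\<close>, bounded everywhere. It
  replaces \<open>d2\<close>, whose value is unspecified where no derivative exists.\<close>

definition section_density :: "(real \<Rightarrow> real \<Rightarrow> real) \<Rightarrow> real \<Rightarrow> (real \<Rightarrow> real) \<Rightarrow> bool" where
  "section_density C u f \<longleftrightarrow> f \<in> borel_measurable borel \<and> (\<forall>t. 0 \<le> f t \<and> f t \<le> 1) \<and>
     (AE t in lborel. t \<in> {0<..<1} \<longrightarrow> (C u has_real_derivative f t) (at t)) \<and>
     (\<forall>a b. 0 \<le> a \<and> a \<le> b \<and> b \<le> 1 \<longrightarrow> (LINT t:{a..b}|lborel. f t) = C u b - C u a)"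

text \<open>The differentiation theorem is about functions on the whole line, so the section is
  extended by constants; clamping is increasing and 1-Lipschitz and keeps both properties.\<close>

lemma section_density_exists:
  assumes C: "copula C" and u: "u \<in> {0..1}"
  obtains f where "section_density C u f"
proof -
  define clamp :: "real \<Rightarrow> real" where "clamp t = max 0 (min 1 t)" for t
  define F where "F t = C u (clamp t)" for t
  have clamp: "0 \<le> clamp t" "clamp t \<le> 1" "x \<le> y \<Longrightarrow> clamp x \<le> clamp y"
      "x \<le> y \<Longrightarrow> clamp y - clamp x \<le> y - x" for t x y
    by (auto simp: clamp_def)
  have "mono F"
    unfolding F_def by (intro monoI copula_section_mono[OF C u] clamp)
  moreover have "F y - F x \<le> y - x" if "x \<le> y" for x y
    using copula_section_lipschitz[OF C u clamp(1) clamp(3)[OF that] clamp(2)] clamp(4)[OF that]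
    unfolding F_def by linarith
  ultimately obtain f where f: "f \<in> borel_measurable borel" "\<And>x. 0 \<le> f x \<and> f x \<le> 1"
      "AE x in lborel. (F has_real_derivative f x) (at x)"
      "\<And>a b. a \<le> b \<Longrightarrow> (LINT t:{a..b}|lborel. f t) = F b - F a"
    using mono_lipschitz_density by blast
  have FC: "F t = C u t" if "t \<in> {0..1}" for t
    using that by (simp add: F_def clamp_def)
  have "AE t in lborel. t \<in> {0<..<1} \<longrightarrow> (C u has_real_derivative f t) (at t)"
    using f(3)
  proof (rule eventually_mono, intro impI)
    fix t assume t: "(F has_real_derivative f t) (at t)" "t \<in> {0<..<1::real}"
    show "(C u has_real_derivative f t) (at t)"
      by (rule has_field_derivative_transform_within_open[OF t(1) _ t(2)]) (auto simp: FC)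
  qed
  then have "section_density C u f"
    using f(1,2,4) by (auto simp: section_density_def FC)
  then show ?thesis by (rule that)
qed

lemma section_densityD:
  assumes "section_density C u f"
  shows "f \<in> borel_measurable borel" "0 \<le> f t" "f t \<le> 1"
    "AE t in lborel. t \<in> {0<..<1} \<longrightarrow> (C u has_real_derivative f t) (at t)"
    "0 \<le> a \<Longrightarrow> a \<le> b \<Longrightarrow> b \<le> 1 \<Longrightarrow> (LINT t:{a..b}|lborel. f t) = C u b - C u a"
    "AE t in lborel. t \<in> {0<..<1} \<longrightarrow> d2 C u t = f t"
  using assms unfolding section_density_def d2_def
  by (auto intro: DERIV_imp_deriv elim!: eventually_mono)

text \<open>By the rectangle inequality \<open>C u2 - C u1\<close> is increasing, so its derivative
  is nonnegative wherever both derivatives exist.\<close>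

lemma section_density_mono:
  assumes C: "copula C" and u: "0 \<le> u1" "u1 \<le> u2" "u2 \<le> 1"
    and f: "section_density C u1 f1" "section_density C u2 f2"
  shows "AE t in lborel. t \<in> {0<..<1} \<longrightarrow> f1 t \<le> f2 t"
  using section_densityD(4)[OF f(1)] section_densityD(4)[OF f(2)]
proof (eventually_elim, intro impI)
  fix t assume t: "t \<in> {0<..<1::real}"
    and "t \<in> {0<..<1} \<longrightarrow> (C u1 has_real_derivative f1 t) (at t)"
    and "t \<in> {0<..<1} \<longrightarrow> (C u2 has_real_derivative f2 t) (at t)"
  then have "((\<lambda>s. C u2 s - C u1 s) has_real_derivative f2 t - f1 t) (at t)"
    by (intro DERIV_diff) auto
  moreover have "mono_on {0..1} (\<lambda>s. C u2 s - C u1 s)"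
  proof (rule mono_onI)
    fix r s :: real assume "r \<in> {0..1}" "s \<in> {0..1}" "r \<le> s"
    then show "C u2 r - C u1 r \<le> C u2 s - C u1 s"
      using copula_increment_mono[OF C u, of r s] by simp
  qed
  ultimately have "f2 t - f1 t \<ge> 0"
    using t by (intro mono_on_imp_deriv_nonneg[of "{0..1}"]) auto
  then show "f1 t \<le> f2 t" by simp
qed

section \<open>From Lebesgue integrals of \<open>d2\<close> to Borel integrals of densities\<close>

lemma borel_measurable_completion_AE:
  assumes f: "f \<in> borel_measurable M" and eq: "AE x in M. h x = f x"
  shows "h \<in> borel_measurable (completion M)"
proof (rule measurableI)
  fix A :: "'b set" assume A: "A \<in> sets borel"
  have "AE x in completion M. x \<in> f -` A \<inter> space M \<longleftrightarrow> x \<in> h -` A \<inter> space (completion M)"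
    using AE_completion[OF eq] by eventually_elim auto
  moreover have "f -` A \<inter> space M \<in> sets (completion M)"
    using measurable_sets[OF f A] by auto
  ultimately show "h -` A \<inter> space (completion M) \<in> sets (completion M)"
    by (rule completion.in_sets_AE) auto
qed simp

text \<open>The definitions integrate over \<open>lebesgue\<close>, while Fubini and monotone
  arguments are run with Borel densities. Agreement is assumed only inside the open interval, since
  the endpoints are null.\<close>

lemma set_integral_lebesgue_eq_lborel:
  fixes f h :: "real \<Rightarrow> real"
  assumes f[measurable]: "f \<in> borel_measurable borel"
    and eq: "AE t in lborel. t \<in> {0<..<1} \<longrightarrow> h t = f t" and ab: "0 \<le> a" "b \<le> 1"
  shows "(LINT t:{a..b}|lebesgue. h t) = (LINT t:{a..b}|lborel. f t)"
proof -
  let ?f = "\<lambda>t. indicator {a..b} t *\<^sub>R f t" and ?h = "\<lambda>t. indicator {a..b} t *\<^sub>R h t"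
  have AE: "AE t in lborel. ?h t = ?f t"
    using eq AE_lborel_singleton[of 0] AE_lborel_singleton[of 1]
    by eventually_elim (use ab in \<open>auto simp: indicator_def\<close>)
  have fm: "?f \<in> borel_measurable lborel" by measurable
  have "integral\<^sup>L lebesgue ?h = integral\<^sup>L lebesgue ?f"
    using borel_measurable_completion_AE[OF fm AE] AE_completion[OF AE] measurable_completion[OF fm]
    by (intro integral_cong_AE) auto
  also have "\<dots> = integral\<^sup>L lborel ?f"
    by (rule integral_completion[OF fm])
  finally show ?thesis by (simp add: set_lebesgue_integral_def)
qed

lemma set_integrable_unit_valued:
  fixes f :: "real \<Rightarrow> real"
  assumes "f \<in> borel_measurable borel" "\<And>t. 0 \<le> f t" "\<And>t. f t \<le> 1"
  shows "set_integrable lborel {a..b} f"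
proof (rule set_integrable_bound[where f = "\<lambda>_. 1::real"])
  show "set_integrable lborel {a..b} (\<lambda>_. 1::real)"
    unfolding set_integrable_def by (auto intro!: integrable_real_indicator simp: emeasure_lborel_Icc_eq)
  show "set_borel_measurable lborel {a..b} f"
    using assms(1) by (simp add: set_borel_measurable_def)
qed (use assms(2,3) in auto)

lemma integral_unit_interval_const: "(LINT t:{0..1::real}|lborel. (c::real)) = c"
  by (simp add: set_lebesgue_integral_def)

lemma d2_Pi_cop: "t \<in> {0<..<1} \<Longrightarrow> v \<in> {0..1} \<Longrightarrow> d2 Pi_cop v t = v"
proof -
  assume tv: "t \<in> {0<..<1::real}" "v \<in> {0..1}"
  have "((\<lambda>s. v * s) has_real_derivative v) (at t)"
    by (auto intro!: derivative_eq_intros)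
  then have "(Pi_cop v has_real_derivative v) (at t)"
    by (rule has_field_derivative_transform_within_open[where S = "{0<..<1}"])
      (use tv in \<open>auto simp: Pi_cop_def\<close>)
  then show ?thesis unfolding d2_def by (rule DERIV_imp_deriv)
qed

text \<open>Stated for any Borel \<open>f\<close> agreeing with \<open>d2\<close>, so that it also
  applies to the second of two iterated joins, where \<open>f\<close> is a level measure.\<close>

lemma join_Pi_cop_eq_AE:
  assumes f[measurable]: "f \<in> borel_measurable borel"
    and eq: "AE t in lborel. t \<in> {0<..<1} \<longrightarrow> d2 C u t = f t"
    and uv: "u \<in> {0..1}" "v \<in> {0..1}"
  shows "join C Pi_cop u v = (LINT t:{0..1}|lborel. min (f t) v)"
proof -
  have "(LINT t:{0..1}|lebesgue. min (d2 C u t) (d2 Pi_cop v t)) = (LINT t:{0..1}|lborel. min (f t) v)"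
  proof (rule set_integral_lebesgue_eq_lborel)
    show "AE t in lborel. t \<in> {0<..<1} \<longrightarrow> min (d2 C u t) (d2 Pi_cop v t) = min (f t) v"
      using eq by (rule eventually_mono) (simp add: d2_Pi_cop[OF _ uv(2)])
  qed auto
  then show ?thesis using uv by (simp add: join_def)
qed

lemma join_Pi_cop_eq:
  assumes "section_density C u f" "u \<in> {0..1}" "v \<in> {0..1}"
  shows "join C Pi_cop u v = (LINT t:{0..1}|lborel. min (f t) v)"
  using join_Pi_cop_eq_AE section_densityD(1,6)[OF assms(1)] assms(2,3) by blast

lemma set_integrable_min_density:
  assumes f: "section_density C u f" and v: "v \<in> {0..1}"
  shows "set_integrable lborel {a..b} (\<lambda>t. min (f t) v)"
  using section_densityD(1-3)[OF f] v
  by (intro set_integrable_unit_valued) (auto simp: min_le_iff_disj)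

section \<open>The join with \<open>Pi_cop\<close> is an SI copula\<close>

lemma AE_unit_interval:
  assumes "AE t in lborel. t \<in> {0<..<1::real} \<longrightarrow> P t"
  shows "AE t \<in> {0..1} in lborel. P t"
  using assms AE_lborel_singleton[of 0] AE_lborel_singleton[of 1]
  by eventually_elim auto

lemma copula_join_Pi_cop:
  assumes C: "copula C"
  shows "copula (join C Pi_cop)"
  unfolding copula_def
proof (intro conjI allI impI ballI)
  fix u v :: real assume "\<not> (u \<in> {0..1} \<and> v \<in> {0..1})"
  then show "join C Pi_cop u v = 0" by (auto simp: join_def)
next
  fix u :: real assume u: "u \<in> {0..1}"
  obtain f where f: "section_density C u f" using section_density_exists[OF C u] .
  have total: "(LINT t:{0..1}|lborel. f t) = u"
    using section_densityD(5)[OF f, of 0 1] copula_boundary[OF C u] by simp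
  have "(LINT t:{0..1}|lborel. min (f t) 0) = 0"
    using section_densityD(2)[OF f] by (simp add: min_absorb2)
  then show "join C Pi_cop u 0 = 0" by (simp add: join_Pi_cop_eq[OF f u])
  have "(LINT t:{0..1}|lborel. min (f t) 1) = (LINT t:{0..1}|lborel. f t)"
    using section_densityD(3)[OF f] by (intro set_lebesgue_integral_cong) auto
  then show "join C Pi_cop u 1 = u" using total by (simp add: join_Pi_cop_eq[OF f u])
next
  fix v :: real assume v: "v \<in> {0..1}"
  have 0: "(0::real) \<in> {0..1}" and 1: "(1::real) \<in> {0..1}" by auto
  obtain f where f: "section_density C 0 f" using section_density_exists[OF C 0] .
  have "(LINT t:{0..1}|lborel. min (f t) v) \<le> (LINT t:{0..1}|lborel. f t)"
    using section_densityD[OF f]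
    by (intro set_integral_mono set_integrable_min_density[OF f v] set_integrable_unit_valued) auto
  also have "\<dots> = 0"
    using section_densityD(5)[OF f, of 0 1] copula_boundary[OF C 0] by simp
  finally have "(LINT t:{0..1}|lborel. min (f t) v) \<le> 0" .
  moreover have "0 \<le> (LINT t:{0..1}|lborel. min (f t) v)"
    unfolding set_lebesgue_integral_def using section_densityD(2)[OF f] v
    by (intro Bochner_Integration.integral_nonneg) (auto simp: indicator_def)
  ultimately show "join C Pi_cop 0 v = 0" by (simp add: join_Pi_cop_eq[OF f 0 v])

  obtain f where f: "section_density C 1 f" using section_density_exists[OF C 1] .
  \<comment> \<open>For values in the unit interval \<open>v * f t \<le> min (f t) v\<close>; as
    \<open>f\<close> has total mass 1, integration gives the lower bound \<open>v\<close>.\<close>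
  have "v = v * (LINT t:{0..1}|lborel. f t)"
    using section_densityD(5)[OF f, of 0 1] copula_boundary[OF C 1] by simp
  also have "\<dots> = (LINT t:{0..1}|lborel. v * f t)" by simp
  also have "\<dots> \<le> (LINT t:{0..1}|lborel. min (f t) v)"
  proof (intro set_integral_mono set_integrable_min_density[OF f v])
    show "set_integrable lborel {0..1} (\<lambda>t. v * f t)"
      using section_densityD[OF f] by (intro set_integrable_mult_right set_integrable_unit_valued) auto
    fix t show "v * f t \<le> min (f t) v"
      using section_densityD(2,3)[OF f, of t] v by (auto intro: mult_left_le mult_left_le_one_le)
  qed
  finally have "v \<le> (LINT t:{0..1}|lborel. min (f t) v)" .
  moreover have "(LINT t:{0..1}|lborel. min (f t) v) \<le> (LINT t:{0..1::real}|lborel. v)"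
    using v by (intro set_integral_mono set_integrable_min_density[OF f v] set_integrable_unit_valued) auto
  ultimately show "join C Pi_cop 1 v = v"
    by (simp only: join_Pi_cop_eq[OF f 1 v] integral_unit_interval_const)
next
  fix u1 u2 v1 v2 :: real
  assume *: "0 \<le> u1 \<and> u1 \<le> u2 \<and> u2 \<le> 1 \<and> 0 \<le> v1 \<and> v1 \<le> v2 \<and> v2 \<le> 1"
  then have u: "u1 \<in> {0..1}" "u2 \<in> {0..1}" and v: "v1 \<in> {0..1}" "v2 \<in> {0..1}" by auto
  obtain f1 where f1: "section_density C u1 f1" using section_density_exists[OF C u(1)] .
  obtain f2 where f2: "section_density C u2 f2" using section_density_exists[OF C u(2)] .
  note int = set_integrable_min_density[OF f1 v(1)] set_integrable_min_density[OF f1 v(2)]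
    set_integrable_min_density[OF f2 v(1)] set_integrable_min_density[OF f2 v(2)]
  \<comment> \<open>Where \<open>f1 \<le> f2\<close>, supermodularity of \<open>min\<close> is the
    pointwise inequality that integrates to the rectangle inequality.\<close>
  have "AE t \<in> {0..1} in lborel. f1 t \<le> f2 t"
    using section_density_mono[OF C _ _ _ f1 f2] * by (intro AE_unit_interval) auto
  then have "(LINT t:{0..1}|lborel. min (f2 t) v1 + min (f1 t) v2)
      \<le> (LINT t:{0..1}|lborel. min (f2 t) v2 + min (f1 t) v1)"
    using * by (intro set_integral_mono_AE set_integral_add int) (auto elim!: eventually_mono)
  then show "0 \<le> join C Pi_cop u2 v2 - join C Pi_cop u2 v1 - join C Pi_cop u1 v2 + join C Pi_cop u1 v1"
    using u v int by (simp add: join_Pi_cop_eq[OF f1] join_Pi_cop_eq[OF f2] set_integral_add)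
qed

lemma concave_join_Pi_cop:
  assumes C: "copula C" and u: "u \<in> {0..1}"
  shows "concave_on {0..1} (join C Pi_cop u)"
  unfolding concave_on_iff
proof (intro conjI ballI allI impI)
  obtain f where f: "section_density C u f" using section_density_exists[OF C u] .
  fix x y a b :: real
  assume xy: "x \<in> {0..1}" "y \<in> {0..1}" and ab: "0 \<le> a" "0 \<le> b" "a + b = 1"
  have z: "a * x + b * y \<in> {0..1}"
    using convexD[OF convex_real_interval(5)[of 0 1] xy ab] by simp
  have "a * (LINT t:{0..1}|lborel. min (f t) x) + b * (LINT t:{0..1}|lborel. min (f t) y)
      = (LINT t:{0..1}|lborel. a * min (f t) x + b * min (f t) y)"
    using set_integrable_min_density[OF f] xy by (simp add: set_integral_add)
  also have "\<dots> \<le> (LINT t:{0..1}|lborel. min (f t) (a * x + b * y))"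
  proof (intro set_integral_mono set_integral_add set_integrable_mult_right set_integrable_min_density[OF f] xy z)
    fix t
    have "a * min (f t) x + b * min (f t) y \<le> a * f t + b * f t"
      using ab by (intro add_mono mult_left_mono) auto
    also have "\<dots> = f t" using ab by (simp add: distrib_right[symmetric])
    finally have "a * min (f t) x + b * min (f t) y \<le> f t" .
    moreover have "a * min (f t) x + b * min (f t) y \<le> a * x + b * y"
      using ab by (intro add_mono mult_left_mono) auto
    ultimately show "a * min (f t) x + b * min (f t) y \<le> min (f t) (a * x + b * y)" by simp
  qed
  finally show "a * join C Pi_cop u x + b * join C Pi_cop u y \<le> join C Pi_cop u (a *\<^sub>R x + b *\<^sub>R y)"
    using xy z by (simp add: join_Pi_cop_eq[OF f u])
qed simp

subsection \<open>Level sets and rearrangement\<close>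

text \<open>For \<open>u = 1\<close> this is one minus the distribution function of \<open>f\<close>
  under the uniform law on the unit interval.\<close>

definition level_measure :: "real \<Rightarrow> (real \<Rightarrow> real) \<Rightarrow> real \<Rightarrow> real" where
  "level_measure u f y = measure lborel {t \<in> {0..u}. y < f t}"

lemma level_set_fmeasurable:
  fixes f :: "real \<Rightarrow> real"
  assumes [measurable]: "f \<in> borel_measurable borel"
  shows "{t \<in> {0..u::real}. y < f t} \<in> fmeasurable lborel"
proof (rule fmeasurableI2[of "{0..u}"])
  show "{t \<in> {0..u}. y < f t} \<in> sets lborel"
    by measurable
qed (auto intro: fmeasurableI simp: emeasure_lborel_Icc_eq)

lemma level_measure_antimono:
  assumes "f \<in> borel_measurable borel" "y \<le> z"
  shows "level_measure u f z \<le> level_measure u f y"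
  unfolding level_measure_def using assms
  by (intro measure_mono_fmeasurable level_set_fmeasurable fmeasurableD[OF level_set_fmeasurable]) auto

lemma level_measure_bounds:
  assumes "f \<in> borel_measurable borel" "0 \<le> u"
  shows "0 \<le> level_measure u f y" "level_measure u f y \<le> u"
proof -
  have "level_measure u f y \<le> measure lborel {0..u}"
    unfolding level_measure_def using assms
    by (intro measure_mono_fmeasurable fmeasurableD[OF level_set_fmeasurable])
      (auto intro: fmeasurableI simp: emeasure_lborel_Icc_eq)
  then show "level_measure u f y \<le> u" using assms by simp
qed (simp add: level_measure_def)

lemma borel_measurable_level_measure:
  assumes "f \<in> borel_measurable borel"
  shows "level_measure u f \<in> borel_measurable borel"
proof -
  have "mono (\<lambda>y. - level_measure u f y)"
    using level_measure_antimono[OF assms] by (auto intro!: monoI)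
  from borel_measurable_uminus[OF borel_measurable_mono[OF this]] show ?thesis by simp
qed

text \<open>Each difference quotient of \<open>G\<close> lies between the values of \<open>g\<close>
  at its two endpoints, so continuity of \<open>g\<close> at \<open>y\<close> forces convergence to
  \<open>g y\<close>. The bounds by \<open>min\<close> and \<open>max\<close> treat both sides of
  \<open>y\<close> together.\<close>

lemma has_derivative_sandwich:
  fixes G g :: "real \<Rightarrow> real"
  assumes G: "\<And>a b. l \<le> a \<Longrightarrow> a < b \<Longrightarrow> b \<le> r \<Longrightarrow>
      (b - a) * g b \<le> G b - G a \<and> G b - G a \<le> (b - a) * g a"
    and y: "l < y" "y < r" and cont: "isCont g y"
  shows "(G has_real_derivative g y) (at y)"
  unfolding has_field_derivative_iff
proof (rule tendsto_sandwich)
  have ev: "\<forall>\<^sub>F z in at y. z \<in> {l<..<r} \<and> z \<noteq> y"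
    using eventually_at_in_open[of "{l<..<r}" y] y by (auto elim!: eventually_mono)
  have q: "min (g y) (g z) \<le> (G z - G y) / (z - y) \<and> (G z - G y) / (z - y) \<le> max (g y) (g z)"
    if "z \<in> {l<..<r} \<and> z \<noteq> y" for z
  proof (cases "y < z")
    case True
    then have "(z - y) * g z \<le> G z - G y" "G z - G y \<le> (z - y) * g y"
      using G[of y z] y that by auto
    then have "g z \<le> (G z - G y) / (z - y)" "(G z - G y) / (z - y) \<le> g y"
      using True by (simp_all add: pos_le_divide_eq pos_divide_le_eq mult.commute)
    then show ?thesis by auto
  next
    case False
    then have "z < y" using that by auto
    then have "(y - z) * g y \<le> G y - G z" "G y - G z \<le> (y - z) * g z"
      using G[of z y] y that by auto
    then have "g y \<le> (G y - G z) / (y - z)" "(G y - G z) / (y - z) \<le> g z"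
      using \<open>z < y\<close> by (simp_all add: pos_le_divide_eq pos_divide_le_eq mult.commute)
    moreover have "(G z - G y) / (z - y) = (G y - G z) / (y - z)"
      by (metis minus_diff_eq minus_divide_divide)
    ultimately show ?thesis by auto
  qed
  show "\<forall>\<^sub>F z in at y. min (g y) (g z) \<le> (G z - G y) / (z - y)"
    using ev by (rule eventually_mono) (use q in blast)
  show "\<forall>\<^sub>F z in at y. (G z - G y) / (z - y) \<le> max (g y) (g z)"
    using ev by (rule eventually_mono) (use q in blast)
  have g: "(g \<longlongrightarrow> g y) (at y)" using cont by (simp add: isCont_def)
  show "((\<lambda>z. min (g y) (g z)) \<longlongrightarrow> g y) (at y)"
    using tendsto_min[OF tendsto_const[of "g y"] g] by simp
  show "((\<lambda>z. max (g y) (g z)) \<longlongrightarrow> g y) (at y)"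
    using tendsto_max[OF tendsto_const[of "g y"] g] by simp
qed

lemma set_integral_level_indicator:
  assumes "f \<in> borel_measurable borel"
  shows "set_integrable lborel {0..1} (\<lambda>t. c * indicator {t. y < f t} t)"
    and "(LINT t:{0..1}|lborel. c * indicator {t. y < f t} t) = c * level_measure 1 f y"
proof -
  have [measurable]: "{t. y < f t} \<in> sets borel" using assms by measurable
  have "set_integrable lborel {0..1} (indicator {t. y < f t} :: real \<Rightarrow> real)"
    by (rule set_integrable_unit_valued) (auto simp: indicator_def)
  then show "set_integrable lborel {0..1} (\<lambda>t. c * indicator {t. y < f t} t)"
    by (rule set_integrable_mult_right)
  have "(LINT t:{0..1}|lborel. indicator {t. y < f t} t :: real)
      = (LINT t|lborel. indicator {t \<in> {0..1}. y < f t} t)"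
    unfolding set_lebesgue_integral_def
    by (intro Bochner_Integration.integral_cong) (auto simp: indicator_def)
  also have "\<dots> = level_measure 1 f y"
    unfolding level_measure_def by simp
  finally show "(LINT t:{0..1}|lborel. c * indicator {t. y < f t} t) = c * level_measure 1 f y"
    by simp
qed

text \<open>For \<open>a < b\<close> the integrand \<open>min (f t) b - min (f t) a\<close> equals
  \<open>b - a\<close> where \<open>f t > b\<close>, vanishes where \<open>f t \<le> a\<close>, and
  lies in between elsewhere. So increments of the join are squeezed between level measures, and the
  derivative exists wherever the monotone level measure is continuous, that is, off a countable
  set.\<close>

lemma d2_join_Pi_cop:
  assumes f: "section_density C u f" and u: "u \<in> {0..1}"
  shows "AE y in lborel. y \<in> {0<..<1} \<longrightarrow> d2 (join C Pi_cop) u y = level_measure 1 f y"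
proof -
  note fm = section_densityD(1)[OF f]
  have sandwich: "(b - a) * level_measure 1 f b \<le> join C Pi_cop u b - join C Pi_cop u a \<and>
      join C Pi_cop u b - join C Pi_cop u a \<le> (b - a) * level_measure 1 f a"
    if ab: "0 \<le> a" "a < b" "b \<le> 1" for a b
  proof -
    have a: "a \<in> {0..1}" and b: "b \<in> {0..1}" using ab by auto
    note int = set_integrable_min_density[OF f a] set_integrable_min_density[OF f b]
    have eq: "join C Pi_cop u b - join C Pi_cop u a = (LINT t:{0..1}|lborel. min (f t) b - min (f t) a)"
      using int by (simp add: join_Pi_cop_eq[OF f u a] join_Pi_cop_eq[OF f u b] set_integral_diff)
    show ?thesis
      unfolding eq set_integral_level_indicator(2)[OF fm, symmetric] using ab
      by (intro conjI set_integral_mono set_integral_diff(1) int set_integral_level_indicator(1)[OF fm])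
        (auto simp: indicator_def min_def)
  qed
  have "mono (\<lambda>y. - level_measure 1 f y)"
    using level_measure_antimono[OF fm] by (auto intro!: monoI)
  then have "countable {y. \<not> isCont (\<lambda>y. - level_measure 1 f y) y}"
    by (rule mono_ctble_discont)
  then have "AE y in lborel. y \<notin> {y. \<not> isCont (\<lambda>y. - level_measure 1 f y) y}"
    by (intro AE_not_in countable_imp_null_set_lborel)
  then show ?thesis
  proof (rule eventually_mono, intro impI)
    fix y assume "y \<notin> {y. \<not> isCont (\<lambda>y. - level_measure 1 f y) y}" and y: "y \<in> {0<..<1::real}"
    then have "isCont (\<lambda>y. - level_measure 1 f y) y" by simp
    from isCont_minus[OF this] have "(join C Pi_cop u has_real_derivative level_measure 1 f y) (at y)"
      using y by (intro has_derivative_sandwich[of 0 1] sandwich) auto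
    then show "d2 (join C Pi_cop) u y = level_measure 1 f y"
      unfolding d2_def by (rule DERIV_imp_deriv)
  qed
qed

text \<open>Fubini for the region under the graph of \<open>g\<close> over \<open>{0..u}\<close>:
  its slices at fixed \<open>t\<close> have length \<open>g t\<close>, those at fixed level
  \<open>y\<close> have the level measure. Levels stop at 1 because \<open>g\<close> does.\<close>

lemma layer_cake:
  assumes g[measurable]: "g \<in> borel_measurable borel" and g01: "\<And>t. 0 \<le> g t" "\<And>t. g t \<le> 1"
  shows "(LINT t:{0..u}|lborel. g t) = (LINT y:{0..1}|lborel. level_measure u g y)"
proof -
  let ?P = "\<lambda>t y. t \<in> {0..u} \<and> 0 \<le> y \<and> y < g t"
  have lm[measurable]: "level_measure u g \<in> borel_measurable borel"
    by (rule borel_measurable_level_measure[OF g])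
  have "(\<integral>\<^sup>+t. ennreal (indicator {0..u} t * g t) \<partial>lborel)
      = (\<integral>\<^sup>+t. (\<integral>\<^sup>+y. indicator {(t, y). ?P t y} (t, y) \<partial>lborel) \<partial>lborel)"
  proof (rule nn_integral_cong)
    fix t
    have "(\<integral>\<^sup>+y. indicator {(t, y). ?P t y} (t, y) \<partial>lborel)
        = (\<integral>\<^sup>+y. indicator (if t \<in> {0..u} then {0..<g t} else {}) y \<partial>lborel)"
      by (intro nn_integral_cong) (auto simp: indicator_def)
    also have "\<dots> = ennreal (indicator {0..u} t * g t)"
      using g01(1)[of t] by (cases "t \<in> {0..u}") auto
    finally show "ennreal (indicator {0..u} t * g t) = (\<integral>\<^sup>+y. indicator {(t, y). ?P t y} (t, y) \<partial>lborel)" ..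
  qed
  also have "\<dots> = (\<integral>\<^sup>+y. (\<integral>\<^sup>+t. indicator {(t, y). ?P t y} (t, y) \<partial>lborel) \<partial>lborel)"
    by (rule lborel_pair.Fubini'[symmetric]) measurable
  also have "\<dots> = (\<integral>\<^sup>+y. ennreal (indicator {0..1} y * level_measure u g y) \<partial>lborel)"
  proof (rule nn_integral_cong)
    fix y
    have sets: "{t \<in> {0..u}. y < g t} \<in> fmeasurable lborel"
      by (rule level_set_fmeasurable[OF g])
    have "(\<integral>\<^sup>+t. indicator {(t, y). ?P t y} (t, y) \<partial>lborel)
        = (\<integral>\<^sup>+t. indicator {0..1} y * indicator {t \<in> {0..u}. y < g t} t \<partial>lborel)"
      using g01(2) by (intro nn_integral_cong) (auto simp: indicator_def intro: less_imp_le less_le_trans)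
    also have "\<dots> = indicator {0..1} y * emeasure lborel {t \<in> {0..u}. y < g t}"
      using sets by (subst nn_integral_cmult) auto
    also have "\<dots> = ennreal (indicator {0..1} y * level_measure u g y)"
      using sets by (auto simp: indicator_def level_measure_def emeasure_eq_measure2)
    finally show "(\<integral>\<^sup>+t. indicator {(t, y). ?P t y} (t, y) \<partial>lborel)
        = ennreal (indicator {0..1} y * level_measure u g y)" .
  qed
  finally have "(\<integral>\<^sup>+t. ennreal (indicator {0..u} t * g t) \<partial>lborel)
      = (\<integral>\<^sup>+y. ennreal (indicator {0..1} y * level_measure u g y) \<partial>lborel)" .
  then show ?thesis
    unfolding set_lebesgue_integral_def real_scaleR_def using g01(1)
    by (subst (1 2) integral_eq_nn_integral) (auto simp: indicator_def level_measure_def)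
qed

text \<open>Up to null sets, level sets of a decreasing function are initial intervals. The
  exceptional set \<open>N\<close> admits densities that are decreasing only where the derivative
  exists, and bad endpoint values.\<close>

lemma level_measure_decreasing:
  assumes g[measurable]: "g \<in> borel_measurable borel"
    and N: "N \<in> null_sets lborel" "antimono_on ({0..1} - N) g" and u: "u \<in> {0..1}"
  shows "level_measure u g y = min u (level_measure 1 g y)"
\<comment> \<open>Either the level set reaches a point at or beyond \<open>u\<close>, and then
  contains almost all of \<open>{0..u}\<close>, or almost all of it lies before
  \<open>u\<close>.\<close>
proof (cases "\<exists>t\<in>{0..1} - N. u \<le> t \<and> y < g t")
  case True
  then obtain t where t: "t \<in> {0..1} - N" "u \<le> t" "y < g t" by blast
  have "AE s in lborel. s \<in> {s \<in> {0..u}. y < g s} \<longleftrightarrow> s \<in> {0..u}"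
    using AE_not_in[OF N(1)]
  proof eventually_elim
    case (elim s)
    then show ?case
      using monotone_onD[OF N(2), of s t] t u by auto
  qed
  then have "level_measure u g y = measure lborel {0..u}"
    unfolding level_measure_def by (intro measure_eq_AE) auto
  then have "level_measure u g y = u" using u by simp
  moreover have "level_measure u g y \<le> level_measure 1 g y"
    unfolding level_measure_def using u
    by (intro measure_mono_fmeasurable fmeasurableD level_set_fmeasurable[OF g]) auto
  ultimately show ?thesis by simp
next
  case False
  have "AE s in lborel. s \<in> {s \<in> {0..u}. y < g s} \<longleftrightarrow> s \<in> {s \<in> {0..1}. y < g s}"
    using AE_not_in[OF N(1)]
  proof eventually_elim
    case (elim s)
    then show ?case using False u by (cases "u \<le> s") auto
  qed
  then have "level_measure u g y = level_measure 1 g y"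
    unfolding level_measure_def by (intro measure_eq_AE) auto
  moreover have "level_measure u g y \<le> u"
    using level_measure_bounds[OF g] u by auto
  ultimately show ?thesis by simp
qed

text \<open>The right-hand side depends on \<open>g\<close> only through
  \<open>level_measure 1 g\<close>, hence is invariant under rearrangement, and it has the shape of
  a join with \<open>Pi_cop\<close>.\<close>

lemma integral_decreasing_eq_level_measure:
  assumes g: "g \<in> borel_measurable borel" "\<And>t. 0 \<le> g t" "\<And>t. g t \<le> 1"
    and N: "N \<in> null_sets lborel" "antimono_on ({0..1} - N) g" and u: "u \<in> {0..1}"
  shows "(LINT t:{0..u}|lborel. g t) = (LINT y:{0..1}|lborel. min (level_measure 1 g y) u)"
  unfolding layer_cake[OF g] level_measure_decreasing[OF g(1) N u]
  by (simp add: min.commute)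

section \<open>Existence and integrals of decreasing rearrangements\<close>

lemma measure_sublevel_eq_level_measure:
  fixes f h :: "real \<Rightarrow> real"
  assumes f[measurable]: "f \<in> borel_measurable borel"
    and eq: "AE t in lborel. t \<in> {0<..<1} \<longrightarrow> h t = f t"
  shows "measure lebesgue {t \<in> {0<..<1}. h t \<le> y} = 1 - level_measure 1 f y"
proof -
  have AE: "AE t in lebesgue. t \<in> {t \<in> {0..1}. f t \<le> y} \<longleftrightarrow> t \<in> {t \<in> {0<..<1}. h t \<le> y}"
    using eq AE_lborel_singleton[of 0] AE_lborel_singleton[of 1]
    by (intro AE_completion, eventually_elim) auto
  have m: "{t \<in> {0..1}. f t \<le> y} \<in> sets lborel" by measurable
  then have m': "{t \<in> {0..1}. f t \<le> y} \<in> sets lebesgue" by simp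
  have "{t \<in> {0<..<1}. h t \<le> y} \<in> sets lebesgue"
    by (rule completion.in_sets_AE[OF AE m']) simp
  then have "measure lebesgue {t \<in> {0<..<1}. h t \<le> y} = measure lebesgue {t \<in> {0..1}. f t \<le> y}"
    using m' AE by (intro measure_eq_AE) auto
  also have "\<dots> = measure lborel {t \<in> {0..1}. f t \<le> y}"
    using m by simp
  also have "{t \<in> {0..1}. f t \<le> y} = {0..1} - {t \<in> {0..1}. y < f t}" by auto
  also have "measure lborel \<dots> = measure lborel {0..1::real} - level_measure 1 f y"
    unfolding level_measure_def
    by (intro measurable_measure_Diff fmeasurableD[OF level_set_fmeasurable[OF f]])
      (auto intro: fmeasurableI simp: emeasure_lborel_Icc_eq)
  finally show ?thesis by simp
qed

lemma decreasing_rearrangement_exists: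
  assumes f[measurable]: "f \<in> borel_measurable borel" and f01: "\<And>t. 0 \<le> f t" "\<And>t. f t \<le> 1"
  shows "\<exists>g::real \<Rightarrow> real. (\<forall>t\<in>{0<..<1}. g t \<in> {0..1}) \<and> antimono_on {0<..<1} g \<and>
      (\<forall>y\<in>{0..1}. measure lebesgue {t\<in>{0<..<1}. g t \<le> y} = 1 - level_measure 1 f y)"
proof -
  let ?U = "restrict_space lborel {0..1::real}"
  define M where "M = distr ?U borel f"
  have "prob_space ?U"
    by (rule prob_spaceI) (simp add: space_restrict_space emeasure_restrict_space)
  moreover have fm: "f \<in> ?U \<rightarrow>\<^sub>M borel"
    by (intro measurable_restrict_space1) simp
  ultimately have "prob_space M"
    unfolding M_def by (intro prob_space.prob_space_distr)
  then have "real_distribution M"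
    by (intro real_distribution.intro real_distribution_axioms.intro) (auto simp: M_def)
  then interpret cdf_distribution M by (rule cdf_distribution.intro)
  have cdf: "cdf M y = 1 - level_measure 1 f y" for y
  proof -
    have "cdf M y = measure ?U (f -` {..y} \<inter> space ?U)"
      unfolding cdf_def M_def by (rule measure_distr[OF fm]) simp
    also have "f -` {..y} \<inter> space ?U = {t \<in> {0..1}. f t \<le> y}"
      by (auto simp: space_restrict_space)
    also have "measure ?U \<dots> = measure lborel {t \<in> {0..1}. f t \<le> y}"
      by (intro measure_restrict_space) auto
    also have "{t \<in> {0..1}. f t \<le> y} = {0..1} - {t \<in> {0..1}. y < f t}" by auto
    also have "measure lborel \<dots> = measure lborel {0..1::real} - level_measure 1 f y"
      unfolding level_measure_def
      by (intro measurable_measure_Diff fmeasurableD[OF level_set_fmeasurable[OF f]])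
        (auto intro: fmeasurableI simp: emeasure_lborel_Icc_eq)
    finally show ?thesis by simp
  qed
  \<comment> \<open>The rearrangement is the quantile function of the law of \<open>f\<close> run backwards; the clamping
    only serves to keep its values in the unit interval everywhere.\<close>
  define Q where "Q w = Inf {x. w \<le> cdf M x}" for w
  have Q: "w \<le> cdf M x \<longleftrightarrow> Q w \<le> x" if "0 < w" "w < 1" for w x
    unfolding Q_def using pseudoinverse[OF that] .
  define g where "g t = max 0 (min 1 (Q (1 - t)))" for t
  have "cdf M 1 = 1"
    unfolding cdf level_measure_def using f01(2) by (simp add: not_less[symmetric])
  \<comment> \<open>For \<open>y < 1\<close> the clamp does not affect the comparison; at
    \<open>y = 1\<close> the left side always holds, and \<open>cdf M 1 = 1\<close> makes the right
    side hold too.\<close>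
  have g_le: "g t \<le> y \<longleftrightarrow> 1 - cdf M y \<le> t" if "t \<in> {0<..<1}" "y \<in> {0..1}" for t y
  proof (cases "y = 1")
    case True
    then show ?thesis using that \<open>cdf M 1 = 1\<close> by (auto simp: g_def)
  next
    case False
    then have "g t \<le> y \<longleftrightarrow> Q (1 - t) \<le> y" using that by (auto simp: g_def)
    also have "\<dots> \<longleftrightarrow> 1 - t \<le> cdf M y" using Q[of "1 - t" y] that by auto
    finally show ?thesis by auto
  qed
  have "antimono_on {0<..<1} g"
  proof (rule monotone_onI)
    fix s t :: real assume st: "s \<in> {0<..<1}" "t \<in> {0<..<1}" "s \<le> t"
    \<comment> \<open>Applying the equivalence to \<open>Q (1 - s)\<close> itself shows that the
      infimum is attained.\<close>
    have "1 - s \<le> cdf M (Q (1 - s))" using Q[of "1 - s" "Q (1 - s)"] st by auto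
    then have "1 - t \<le> cdf M (Q (1 - s))" using st by auto
    then have "Q (1 - t) \<le> Q (1 - s)" using Q[of "1 - t" "Q (1 - s)"] st by auto
    then show "g t \<le> g s" by (auto simp: g_def)
  qed
  moreover have "measure lebesgue {t\<in>{0<..<1}. g t \<le> y} = 1 - level_measure 1 f y" if y: "y \<in> {0..1}" for y
  proof -
    have "{t\<in>{0<..<1}. g t \<le> y} = {t\<in>{0<..<1}. 1 - cdf M y \<le> t}"
      using g_le y by auto
    then have "measure lebesgue {t\<in>{0<..<1}. g t \<le> y} = measure lebesgue {t\<in>{0<..<1}. 1 - cdf M y \<le> t}"
      by simp
    also have "\<dots> = measure lborel {t\<in>{0<..<1}. 1 - cdf M y \<le> t}"
      by (intro measure_completion) measurable
    also have "\<dots> = measure lborel {1 - cdf M y..1}"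
    proof (rule measure_eq_AE)
      show "AE t in lborel. t \<in> {t\<in>{0<..<1}. 1 - cdf M y \<le> t} \<longleftrightarrow> t \<in> {1 - cdf M y..1}"
        using AE_lborel_singleton[of 0] AE_lborel_singleton[of 1]
        by eventually_elim (use cdf_bounded_prob[of y] in auto)
    qed auto
    also have "\<dots> = cdf M y" using cdf_nonneg[of y] by simp
    finally show ?thesis by (simp add: cdf)
  qed
  ultimately show ?thesis
    by (intro exI[of _ g]) (auto simp: g_def)
qed

text \<open>\<open>decr_rearr\<close> chooses among several functions, but each is decreasing with
  the level measures of \<open>f\<close>, and these determine the integral.\<close>

lemma integral_decr_rearr:
  assumes f: "f \<in> borel_measurable borel" "\<And>t. 0 \<le> f t" "\<And>t. f t \<le> 1"
    and eq: "AE t in lborel. t \<in> {0<..<1} \<longrightarrow> h t = f t" and u: "u \<in> {0..1}"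
  shows "(LINT t:{0..u}|lebesgue. decr_rearr h t) = (LINT y:{0..1}|lborel. min (level_measure 1 f y) u)"
proof -
  define g where "g = decr_rearr h"
  have "(\<forall>t\<in>{0<..<1}. g t \<in> {0..1}) \<and> antimono_on {0<..<1} g \<and>
      (\<forall>y\<in>{0..1}. measure lebesgue {t\<in>{0<..<1}. g t \<le> y} = measure lebesgue {t\<in>{0<..<1}. h t \<le> y})"
    unfolding g_def decr_rearr_def measure_sublevel_eq_level_measure[OF f(1) eq]
    by (rule someI_ex[OF decreasing_rearrangement_exists[OF f]])
  then have g: "\<And>t. t \<in> {0<..<1} \<Longrightarrow> g t \<in> {0..1}" "antimono_on {0<..<1} g"
    "\<And>y. y \<in> {0..1} \<Longrightarrow> measure lebesgue {t\<in>{0<..<1}. g t \<le> y} = 1 - level_measure 1 f y"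
    unfolding measure_sublevel_eq_level_measure[OF f(1) eq] by blast+
  \<comment> \<open>The chosen function is constrained on the open interval only; the value 0
    elsewhere makes it Borel and bounded everywhere. It may break monotonicity at 0, so the
    endpoints are treated as exceptional below.\<close>
  define G where "G t = (if t \<in> {0<..<1} then g t else 0)" for t
  have G01: "0 \<le> G t" "G t \<le> 1" for t using g(1)[of t] by (auto simp: G_def)
  have "(\<lambda>t. - g t) \<in> borel_measurable (restrict_space borel {0<..<1})"
    using g(2) by (intro borel_measurable_mono_on_fnc) (auto simp: monotone_on_def)
  from borel_measurable_uminus[OF this]
  have "g \<in> borel_measurable (restrict_space borel {0<..<1})" by simp
  then have Gm: "G \<in> borel_measurable borel"
    unfolding G_def by (subst (asm) measurable_restrict_space_iff[where c = 0]) auto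
  have Geq: "AE t in lborel. t \<in> {0<..<1} \<longrightarrow> g t = G t" by (simp add: G_def)
  have level: "level_measure 1 G y = level_measure 1 f y" if "y \<in> {0..1}" for y
    using measure_sublevel_eq_level_measure[OF Gm Geq, of y] g(3)[OF that] by simp
  have "(LINT t:{0..u}|lebesgue. g t) = (LINT t:{0..u}|lborel. G t)"
    using u by (intro set_integral_lebesgue_eq_lborel Gm Geq) auto
  also have "\<dots> = (LINT y:{0..1}|lborel. min (level_measure 1 G y) u)"
  proof (rule integral_decreasing_eq_level_measure[OF Gm G01 _ _ u])
    show "{0, 1::real} \<in> null_sets lborel" by (rule finite_imp_null_set_lborel) simp
    show "antimono_on ({0..1} - {0, 1}) G"
      using g(2) by (auto simp: monotone_on_def G_def)
  qed
  also have "\<dots> = (LINT y:{0..1}|lborel. min (level_measure 1 f y) u)"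
    by (intro set_lebesgue_integral_cong) (auto simp: level)
  finally show ?thesis by (simp add: g_def)
qed

subsection \<open>The three classes\<close>

lemma SI_up_eq:
  assumes f: "section_density C v f" and uv: "u \<in> {0..1}" "v \<in> {0..1}"
  shows "SI_up C v u = (LINT y:{0..1}|lborel. min (level_measure 1 f y) u)"
  using integral_decr_rearr[OF section_densityD(1-3,6)[OF f] uv(1)] uv
  by (simp add: SI_up_def)

text \<open>The first join has the level measure as derivative; the second integrates its minimum
  with \<open>u\<close>, which is the formula for \<open>SI_up\<close>. Outside the square both
  sides are 0 by convention.\<close>

lemma SI_up_eq_join_join:
  assumes C: "copula C"
  shows "SI_up C = join (join C Pi_cop) Pi_cop"
proof (intro ext)
  fix v u
  show "SI_up C v u = join (join C Pi_cop) Pi_cop v u"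
  proof (cases "v \<in> {0..1} \<and> u \<in> {0..1}")
    case True
    then have v: "v \<in> {0..1}" and u: "u \<in> {0..1}" by auto
    obtain f where f: "section_density C v f" using section_density_exists[OF C v] .
    show ?thesis
      unfolding SI_up_eq[OF f u v]
      by (rule join_Pi_cop_eq_AE[OF _ d2_join_Pi_cop[OF f v] v u, symmetric])
        (rule borel_measurable_level_measure[OF section_densityD(1)[OF f]])
  next
    case False
    then show ?thesis by (auto simp: SI_up_def join_def)
  qed
qed

text \<open>The tangent of the convex function \<open>- G\<close> at \<open>s\<close> lies below it
  at \<open>t\<close>, and the tangent at \<open>t\<close> below it at \<open>s\<close>; the two
  inequalities are added.\<close>

lemma concave_on_derivative_antimono:
  fixes G :: "real \<Rightarrow> real"
  assumes G: "concave_on A G" and st: "s \<in> interior A" "t \<in> interior A" "s \<le> t"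
    and deriv: "(G has_real_derivative a) (at s)" "(G has_real_derivative b) (at t)"
  shows "b \<le> a"
proof (cases "s = t")
  case True
  then show ?thesis using deriv DERIV_unique by auto
next
  case False
  have convex: "convex_on A (\<lambda>x. - G x)" using G by (simp add: concave_on_def)
  then have conn: "connected A" by (intro convex_connected convex_on_imp_convex)
  have mem: "s \<in> A" "t \<in> A" using st(1,2) interior_subset by blast+
  have minus: "((\<lambda>x. - G x) has_real_derivative - a) (at s within A)"
    "((\<lambda>x. - G x) has_real_derivative - b) (at t within A)"
    using deriv[THEN DERIV_minus, THEN has_field_derivative_at_within] .
  have "- G t - (- G s) \<ge> - a * (t - s)"
    by (rule convex_on_imp_above_tangent[OF convex conn st(1) mem(2) minus(1)])
  moreover have "- G s - (- G t) \<ge> - b * (s - t)"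
    by (rule convex_on_imp_above_tangent[OF convex conn st(2) mem(1) minus(2)])
  ultimately have "b * (t - s) \<le> a * (t - s)" by (simp add: algebra_simps)
  then show ?thesis using st(3) False by simp
qed

text \<open>By concavity the density \<open>f\<close> is itself decreasing off a null set, so its
  integral obeys the same level-measure formula as that of its rearrangement, and this integral is
  \<open>C v u\<close>.\<close>

lemma SI_up_fixes_SI_copulas:
  assumes "C \<in> SI_copulas"
  shows "SI_up C = C"
proof (intro ext)
  have C: "copula C" using assms by (simp add: SI_copulas_def)
  fix v u
  show "SI_up C v u = C v u"
  proof (cases "v \<in> {0..1} \<and> u \<in> {0..1}")
    case True
    then have v: "v \<in> {0..1}" and u: "u \<in> {0..1}" by auto
    have conc: "concave_on {0..1} (C v)" using assms v by (simp add: SI_copulas_def)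
    obtain f where f: "section_density C v f" using section_density_exists[OF C v] .
    obtain N where N: "N \<in> null_sets lborel"
        "{t. \<not> (t \<in> {0<..<1} \<longrightarrow> (C v has_real_derivative f t) (at t))} \<subseteq> N"
      using section_densityD(4)[OF f] by (auto simp: eventually_ae_filter)
    have "N \<union> {0, 1} \<in> null_sets lborel"
      by (rule null_sets.Un[OF N(1) finite_imp_null_set_lborel]) simp
    moreover have "antimono_on ({0..1} - (N \<union> {0, 1})) f"
    proof (rule monotone_onI)
      fix s t assume st: "s \<in> {0..1} - (N \<union> {0, 1})" "t \<in> {0..1} - (N \<union> {0, 1})" "s \<le> t"
      then have "s \<in> {0<..<1} - N" "t \<in> {0<..<1} - N" by auto
      then have "(C v has_real_derivative f s) (at s)" "(C v has_real_derivative f t) (at t)"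
        using N(2) by blast+
      moreover have "s \<in> interior {0..1}" "t \<in> interior {0..1}" using st by auto
      ultimately show "f t \<le> f s"
        using concave_on_derivative_antimono[OF conc] \<open>s \<le> t\<close> by blast
    qed
    ultimately have "(LINT t:{0..u}|lborel. f t) = SI_up C v u"
      unfolding SI_up_eq[OF f u v]
      by (rule integral_decreasing_eq_level_measure[OF section_densityD(1-3)[OF f] _ _ u])
    moreover have "(LINT t:{0..u}|lborel. f t) = C v u"
      using section_densityD(5)[OF f, of 0 u] u copula_boundary(1)[OF C v] by simp
    ultimately show ?thesis by simp
  next
    case False
    moreover from C this have "C v u = 0" unfolding copula_def by blast
    ultimately show ?thesis by (auto simp: SI_up_def)
  qed
qed

theorem mainTheorem6:
  shows "{join C Pi_cop | C. C \<in> copulas} = {SI_up C | C. C \<in> copulas}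
       \<and> {SI_up C | C. C \<in> copulas} = SI_copulas"
proof -
  \<comment> \<open>The inclusions form a cycle; this one holds because \<open>SI_up C\<close> is
    the join of the copula \<open>join C Pi_cop\<close> with \<open>Pi_cop\<close>.\<close>
  have "{SI_up C | C. C \<in> copulas} \<subseteq> {join C Pi_cop | C. C \<in> copulas}"
    using SI_up_eq_join_join copula_join_Pi_cop by (fastforce simp: copulas_def)
  moreover have "{join C Pi_cop | C. C \<in> copulas} \<subseteq> SI_copulas"
    using copula_join_Pi_cop concave_join_Pi_cop by (auto simp: copulas_def SI_copulas_def)
  moreover have "SI_copulas \<subseteq> {SI_up C | C. C \<in> copulas}"
  proof
    fix C assume "C \<in> SI_copulas"
    then have "C = SI_up C" "C \<in> copulas"
      using SI_up_fixes_SI_copulas by (auto simp: copulas_def SI_copulas_def)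
    then show "C \<in> {SI_up C | C. C \<in> copulas}" by blast
  qed
  ultimately show ?thesis by blast
qed

end
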